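(* Let $F^{n}=(M^{n},L)$ be an $n$-dimensional Finsler space, let $\sigma$ be a smooth function on $M^{n}$ and let $\beta(x,y)=b_{i}(x)y^{i}$ be a 1-form on $M^{n}$. Let $F^{*n}=(M^{n},L^{*})$ be the Finsler space obtained from $F^{n}$ by the Randers conformal change $L^{*}(x,y)=e^{\sigma(x)}L(x,y)+\beta(x,y)$. Define $$A_{i}=e^{\sigma}L\,\partial_{i}\sigma+\partial_{i}\beta-\frac{db_{i}}{dt}.$$ If the covariant vector $A_{i}$ vanishes identically, then the change $L\rightarrow L^{*}$ is projective.
   Context: A Finsler space $F^{n}=(M^{n},L)$ is an $n$-dimensional smooth manifold $M^{n}$ with a fundamental function $L(x,y)>0$, smooth for nonzero tangent vectors $y$ and positively homogeneous of degree one in $y$, whose fundamental tensor $g_{ij}=\frac12\dot\partial_{i}\dot\partial_{j}L^{2}$ is nondegenerate. Here $\partial_{i}=\partial/\partial x^{i}$ and $\dot\partial_{i}=\partial/\partial y^{i}$. It is assumed that $L^{*}$ is also the fundamental function of a Finsler space (in particular $L^{*}>0$). Along a curve $x(t)$ one puts $y^{i}=dx^{i}/dt$. Then $db_{i}/dt=y^{j}\partial_{j}b_{i}(x)$ and $\partial_{i}\beta=y^{j}\partial_{i}b_{j}(x)$, so that $A_{i}$ is a function of $(x,y)$; "vanishes identically" means that it is zero for all $i$ and all $(x,y)$. A geodesic of $(M^{n},L)$ is a regular curve satisfying the Euler-Lagrange equations $B_{i}=0$, where $B_{i}=\partial_{i}L-\frac{d}{dt}(\dot\partial_{i}L)$ (these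 equations are invariant under orientation-preserving reparametrization). The change $L\rightarrow L^{*}$ is called projective if every geodesic of $(M^{n},L)$ is also a geodesic of $(M^{n},L^{*})$ and conversely. *)

theory Defs
  imports "HOL-Analysis.Analysis"
begin

text \<open>Only used on open sets \<open>S\<close>, where derivatives within \<open>S\<close> are ordinary derivatives.\<close>

primrec Ck_on :: "nat \<Rightarrow> 'a::euclidean_space set \<Rightarrow> ('a \<Rightarrow> 'b::real_normed_vector) \<Rightarrow> bool" where
  "Ck_on 0 S f \<longleftrightarrow> continuous_on S f"
| "Ck_on (Suc k) S f \<longleftrightarrow>
     (\<forall>x\<in>S. f differentiable (at x)) \<and>
     (\<forall>e\<in>Basis. Ck_on k S (\<lambda>x. frechet_derivative f (at x) e))"

definition smooth_on :: "'a::euclidean_space set \<Rightarrow> ('a \<Rightarrow> 'b::real_normed_vector) \<Rightarrow> bool" where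
  "smooth_on S f \<longleftrightarrow> (\<forall>k. Ck_on k S f)"

definition pd :: "'n \<Rightarrow> (real^'n::finite \<Rightarrow> real) \<Rightarrow> real^'n \<Rightarrow> real" where
  "pd i f x = frechet_derivative f (at x) (axis i 1)"

text \<open>A chart is an open subset of \<open>'m\<close> together with its coordinate map, of which only the
  values on that subset matter.\<close>

type_synonym ('m, 'n) chart = "'m set \<times> ('m \<Rightarrow> real^'n)"

abbreviation chart_dom :: "('m, 'n) chart \<Rightarrow> 'm set" where
  "chart_dom c \<equiv> fst c"

abbreviation coord :: "('m, 'n) chart \<Rightarrow> 'm \<Rightarrow> real^'n" where
  "coord c \<equiv> snd c"

abbreviation chart_image :: "('m, 'n) chart \<Rightarrow> (real^'n) set" where
  "chart_image c \<equiv> coord c ` chart_dom c"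

abbreviation chart_inv :: "('m, 'n) chart \<Rightarrow> real^'n \<Rightarrow> 'm" where
  "chart_inv c \<equiv> inv_into (chart_dom c) (coord c)"

definition is_chart :: "('m::topological_space, 'n::finite) chart \<Rightarrow> bool" where
  "is_chart c \<longleftrightarrow> open (chart_dom c) \<and> open (chart_image c) \<and>
     homeomorphism (chart_dom c) (chart_image c) (coord c) (chart_inv c)"

definition transition :: "('m, 'n) chart \<Rightarrow> ('m, 'n) chart \<Rightarrow> real^'n \<Rightarrow> real^'n" where
  "transition c d = coord d \<circ> chart_inv c"

text \<open>The manifold is the whole type \<open>'m\<close>, its dimension is the cardinality of \<open>'n\<close>, and its
  smooth structure is given by a (not necessarily maximal) smooth atlas.\<close>

definition smooth_manifold ::
    "('m::{t2_space, second_countable_topology}, 'n::finite) chart set \<Rightarrow> bool" where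
  "smooth_manifold A \<longleftrightarrow>
     (\<forall>c\<in>A. is_chart c) \<and>
     (\<Union>c\<in>A. chart_dom c) = UNIV \<and>
     (\<forall>c\<in>A. \<forall>d\<in>A. smooth_on (coord c ` (chart_dom c \<inter> chart_dom d)) (transition c d))"

text \<open>A tangent vector at \<open>p\<close> is a contravariant vector: a family of components, one tuple for each
  chart around \<open>p\<close>, transforming by the Jacobians of the coordinate changes. The value at all other
  charts is normalised to \<open>0\<close>, so that equal components mean equal tangent vectors.\<close>

type_synonym ('m, 'n) tangent = "('m, 'n) chart \<Rightarrow> real^'n"

definition tangent_space ::
    "('m, 'n::finite) chart set \<Rightarrow> 'm \<Rightarrow> ('m, 'n) tangent set" where
  "tangent_space A p = {v.
     (\<forall>c\<in>A. \<forall>d\<in>A. p \<in> chart_dom c \<inter> chart_dom d \<longrightarrow>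
        v d = frechet_derivative (transition c d) (at (coord c p)) (v c)) \<and>
     (\<forall>c. \<not> (c \<in> A \<and> p \<in> chart_dom c) \<longrightarrow> v c = 0)}"

text \<open>The tangent vector at the point with coordinates \<open>x\<close> having components \<open>y\<close> in the chart \<open>c\<close>.\<close>

definition of_components ::
    "('m, 'n::finite) chart set \<Rightarrow> ('m, 'n) chart \<Rightarrow> real^'n \<Rightarrow> real^'n \<Rightarrow> ('m, 'n) tangent" where
  "of_components A c x y = (\<lambda>d.
     if d \<in> A \<and> chart_inv c x \<in> chart_dom d
     then frechet_derivative (transition c d) (at x) y else 0)"

text \<open>Functions on the tangent bundle are curried, and only their values at \<open>p\<close> and
  \<open>v \<in> tangent_space A p\<close> matter. \<open>local_rep A F c x y\<close> is the expression \<open>F(x,y)\<close> in the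
  canonical coordinates induced by the chart \<open>c\<close>.\<close>

definition local_rep ::
    "('m, 'n::finite) chart set \<Rightarrow> ('m \<Rightarrow> ('m, 'n) tangent \<Rightarrow> real) \<Rightarrow> ('m, 'n) chart
      \<Rightarrow> real^'n \<Rightarrow> real^'n \<Rightarrow> real" where
  "local_rep A F c x y = F (chart_inv c x) (of_components A c x y)"

definition smooth_function :: "('m, 'n::finite) chart set \<Rightarrow> ('m \<Rightarrow> real) \<Rightarrow> bool" where
  "smooth_function A f \<longleftrightarrow> (\<forall>c\<in>A. smooth_on (chart_image c) (f \<circ> chart_inv c))"

text \<open>\<open>one_form_coeff A \<beta> c i\<close> is the component \<open>b\<^sub>i\<close> of \<open>\<beta>\<close> in the chart \<open>c\<close>.\<close>

definition one_form_coeff ::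
    "('m, 'n::finite) chart set \<Rightarrow> ('m \<Rightarrow> ('m, 'n) tangent \<Rightarrow> real) \<Rightarrow> ('m, 'n) chart
      \<Rightarrow> 'n \<Rightarrow> real^'n \<Rightarrow> real" where
  "one_form_coeff A \<beta> c i x = local_rep A \<beta> c x (axis i 1)"

definition one_form ::
    "('m, 'n::finite) chart set \<Rightarrow> ('m \<Rightarrow> ('m, 'n) tangent \<Rightarrow> real) \<Rightarrow> bool" where
  "one_form A \<beta> \<longleftrightarrow>
     (\<forall>p. \<forall>v\<in>tangent_space A p. \<forall>w\<in>tangent_space A p. \<forall>r s.
        \<beta> p (\<lambda>c. r *\<^sub>R v c + s *\<^sub>R w c) = r * \<beta> p v + s * \<beta> p w) \<and>
     (\<forall>c\<in>A. \<forall>i. smooth_on (chart_image c) (one_form_coeff A \<beta> c i))"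

definition fundamental_tensor ::
    "('m, 'n::finite) chart set \<Rightarrow> ('m \<Rightarrow> ('m, 'n) tangent \<Rightarrow> real) \<Rightarrow> ('m, 'n) chart
      \<Rightarrow> real^'n \<Rightarrow> real^'n \<Rightarrow> real^'n^'n" where
  "fundamental_tensor A L c x y =
     (\<chi> i j. 1/2 * pd i (pd j (\<lambda>z. (local_rep A L c x z)\<^sup>2)) y)"

text \<open>All conditions concern nonzero tangent vectors; nothing is required of \<open>L\<close> on the zero
  section.\<close>

definition finsler_space ::
    "('m::{t2_space, second_countable_topology}, 'n::finite) chart set
      \<Rightarrow> ('m \<Rightarrow> ('m, 'n) tangent \<Rightarrow> real) \<Rightarrow> bool" where
  "finsler_space A L \<longleftrightarrow>
     smooth_manifold A \<and>
     (\<forall>p. \<forall>v\<in>tangent_space A p. v \<noteq> (\<lambda>_. 0) \<longrightarrow> L p v > 0) \<and>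
     (\<forall>p. \<forall>v\<in>tangent_space A p. v \<noteq> (\<lambda>_. 0) \<longrightarrow>
        (\<forall>r>0. L p (\<lambda>c. r *\<^sub>R v c) = r * L p v)) \<and>
     (\<forall>c\<in>A. smooth_on (chart_image c \<times> (- {0})) (\<lambda>(x, y). local_rep A L c x y)) \<and>
     (\<forall>c\<in>A. \<forall>x\<in>chart_image c. \<forall>y. y \<noteq> 0 \<longrightarrow> det (fundamental_tensor A L c x y) \<noteq> 0)"

definition regular_curve ::
    "('m::topological_space, 'n::finite) chart set \<Rightarrow> real set \<Rightarrow> (real \<Rightarrow> 'm) \<Rightarrow> bool" where
  "regular_curve A I \<gamma> \<longleftrightarrow>
     open I \<and> is_interval I \<and> I \<noteq> {} \<and> continuous_on I \<gamma> \<and>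
     (\<forall>c\<in>A. smooth_on {t\<in>I. \<gamma> t \<in> chart_dom c} (coord c \<circ> \<gamma>) \<and>
        (\<forall>t\<in>I. \<gamma> t \<in> chart_dom c \<longrightarrow> vector_derivative (coord c \<circ> \<gamma>) (at t) \<noteq> 0))"

text \<open>\<open>B\<^sub>i = \<partial>L/\<partial>x\<^sup>i - d/dt (\<partial>L/\<partial>y\<^sup>i)\<close> along \<open>\<gamma>\<close> at time \<open>t\<close>, with \<open>y = dx/dt\<close>.\<close>

definition euler_lagrange ::
    "('m, 'n::finite) chart set \<Rightarrow> ('m \<Rightarrow> ('m, 'n) tangent \<Rightarrow> real) \<Rightarrow> ('m, 'n) chart
      \<Rightarrow> (real \<Rightarrow> 'm) \<Rightarrow> 'n \<Rightarrow> real \<Rightarrow> real" where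
  "euler_lagrange A L c \<gamma> i t =
     (let x = coord c \<circ> \<gamma>;
          y = (\<lambda>s. vector_derivative x (at s))
      in pd i (\<lambda>z. local_rep A L c z (y t)) (x t)
         - deriv (\<lambda>s. pd i (local_rep A L c (x s)) (y s)) t)"

definition geodesic ::
    "('m::topological_space, 'n::finite) chart set \<Rightarrow> ('m \<Rightarrow> ('m, 'n) tangent \<Rightarrow> real)
      \<Rightarrow> real set \<Rightarrow> (real \<Rightarrow> 'm) \<Rightarrow> bool" where
  "geodesic A L I \<gamma> \<longleftrightarrow> regular_curve A I \<gamma> \<and>
     (\<forall>c\<in>A. \<forall>t\<in>I. \<gamma> t \<in> chart_dom c \<longrightarrow> (\<forall>i. euler_lagrange A L c \<gamma> i t = 0))"

definition projective_change ::
    "('m::topological_space, 'n::finite) chart set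
      \<Rightarrow> ('m \<Rightarrow> ('m, 'n) tangent \<Rightarrow> real) \<Rightarrow> ('m \<Rightarrow> ('m, 'n) tangent \<Rightarrow> real) \<Rightarrow> bool" where
  "projective_change A L L' \<longleftrightarrow> (\<forall>I \<gamma>. geodesic A L I \<gamma> \<longleftrightarrow> geodesic A L' I \<gamma>)"

definition randers_conformal ::
    "('m \<Rightarrow> real) \<Rightarrow> ('m \<Rightarrow> ('m, 'n) tangent \<Rightarrow> real) \<Rightarrow> ('m \<Rightarrow> ('m, 'n) tangent \<Rightarrow> real)
      \<Rightarrow> 'm \<Rightarrow> ('m, 'n) tangent \<Rightarrow> real" where
  "randers_conformal \<sigma> \<beta> L p v = exp (\<sigma> p) * L p v + \<beta> p v"

text \<open>The covector \<open>A\<^sub>i = e\<^sup>\<sigma> L \<partial>\<^sub>i\<sigma> + \<partial>\<^sub>i\<beta> - db\<^sub>i/dt\<close> as a function of \<open>(x,y)\<close> in the chart \<open>c\<close>: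
  \<open>\<partial>\<^sub>i\<beta>\<close> is taken at fixed \<open>y\<close>, and \<open>db\<^sub>i/dt\<close> stands for the sum of \<open>y\<^sup>j \<partial>\<^sub>j b\<^sub>i\<close> over \<open>j\<close>.\<close>

definition randers_covector ::
    "('m, 'n::finite) chart set \<Rightarrow> ('m \<Rightarrow> real) \<Rightarrow> ('m \<Rightarrow> ('m, 'n) tangent \<Rightarrow> real)
      \<Rightarrow> ('m \<Rightarrow> ('m, 'n) tangent \<Rightarrow> real) \<Rightarrow> ('m, 'n) chart \<Rightarrow> 'n \<Rightarrow> real^'n \<Rightarrow> real^'n \<Rightarrow> real" where
  "randers_covector A \<sigma> \<beta> L c i x y =
     exp (\<sigma> (chart_inv c x)) * local_rep A L c x y * pd i (\<sigma> \<circ> chart_inv c) x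
     + pd i (\<lambda>z. local_rep A \<beta> c z y) x
     - (\<Sum>j\<in>UNIV. y $ j * pd j (one_form_coeff A \<beta> c i) x)"

end

theory Submission
  imports Defs
begin

text \<open>
  Write \<open>B\<^sub>i\<close> and \<open>B\<^sup>*\<^sub>i\<close> for the Euler-Lagrange expressions of \<open>L\<close> and of
  \<open>L\<^sup>* = e\<^sup>\<sigma> L + \<beta>\<close> along a curve. As \<open>\<partial>L\<^sup>*/\<partial>y\<^sup>i = e\<^sup>\<sigma> \<partial>L/\<partial>y\<^sup>i + b\<^sub>i\<close>, differentiating along the
  curve produces, besides \<open>e\<^sup>\<sigma> B\<^sub>i\<close> and the terms collected in \<open>A\<^sub>i\<close>, exactly one more term:
  \<open>B\<^sup>*\<^sub>i = e\<^sup>\<sigma> B\<^sub>i + A\<^sub>i - e\<^sup>\<sigma> (d\<sigma>/dt) \<partial>L/\<partial>y\<^sup>i\<close>.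
  This is \<open>randers_euler_lagrange\<close>.

  The last term is removed by contracting \<open>A\<^sub>i\<close> with \<open>y\<^sup>i\<close> (\<open>randers_covector_contraction\<close>): the
  \<open>\<beta>\<close>-part of \<open>A\<^sub>i\<close> is \<open>y\<^sup>j (\<partial>\<^sub>i b\<^sub>j - \<partial>\<^sub>j b\<^sub>i)\<close>, the contraction of the 2-form \<open>d\<beta>\<close> with \<open>y\<close>, so
  by skew-symmetry \<open>A\<^sub>i y\<^sup>i = e\<^sup>\<sigma> L y\<^sup>i \<partial>\<^sub>i\<sigma>\<close>. Since \<open>L > 0\<close> on nonzero vectors, \<open>A\<^sub>i = 0\<close> forces
  \<open>y\<^sup>i \<partial>\<^sub>i\<sigma> = 0\<close>, hence \<open>d\<sigma>/dt = 0\<close> along every regular curve. What remains is \<open>B\<^sup>*\<^sub>i = e\<^sup>\<sigma> B\<^sub>i\<close>, and the two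
  systems of equations have the same solutions.

  Two points need care. Positivity of \<open>L\<close> and linearity of \<open>\<beta>\<close> are properties of
  tangent vectors; to use them for coordinate expressions one must know that a tuple of components
  in one chart defines a tangent vector, which is the chain rule for coordinate changes
  (\<open>of_components_in_tangent_space\<close>). And the time derivative in \<open>B\<^sup>*\<^sub>i\<close> can be split into summands
  only because each summand is differentiable along the curve; for the momentum \<open>\<partial>L/\<partial>y\<^sup>i\<close> this is
  \<open>finsler_momentum_differentiable\<close> together with \<open>regular_curve_coordinates\<close>.
\<close>

section \<open>Partial derivatives of smooth functions\<close>

lemma smooth_on_differentiable:
  assumes "smooth_on S f" "x \<in> S"
  shows "f differentiable (at x)"
proof -
  have "Ck_on (Suc 0) S f" using assms(1) unfolding smooth_on_def by blast
  then show ?thesis using assms(2) by simp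
qed

lemma smooth_on_frechet_derivative_Basis:
  assumes "smooth_on S f" "e \<in> Basis"
  shows "smooth_on S (\<lambda>x. frechet_derivative f (at x) e)"
  unfolding smooth_on_def
proof
  fix k
  have "Ck_on (Suc k) S f" using assms(1) unfolding smooth_on_def by blast
  then show "Ck_on k S (\<lambda>x. frechet_derivative f (at x) e)" using assms(2) by simp
qed

lemma pd_eqI:
  assumes "(f has_derivative D) (at x)"
  shows "pd i f x = D (axis i 1)"
  using frechet_derivative_at[OF assms] by (simp add: pd_def)

lemma sum_components_axis: "(\<Sum>j\<in>UNIV. v $ j *\<^sub>R axis j (1::real)) = v"
  using basis_expansion[of v] by (simp add: scalar_mult_eq_scaleR)

lemma frechet_derivative_eq_sum_pd:
  fixes f :: "real^'n::finite \<Rightarrow> real"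
  assumes "f differentiable (at x)"
  shows "frechet_derivative f (at x) v = (\<Sum>j\<in>UNIV. v $ j * pd j f x)"
proof -
  have "linear (frechet_derivative f (at x))"
    by (rule linear_frechet_derivative[OF assms])
  then have "frechet_derivative f (at x) (\<Sum>j\<in>UNIV. v $ j *\<^sub>R axis j 1)
      = (\<Sum>j\<in>UNIV. v $ j *\<^sub>R frechet_derivative f (at x) (axis j 1))"
    by (simp add: linear_sum linear_cmul)
  then show ?thesis by (simp add: sum_components_axis pd_def)
qed

lemma has_real_derivative_along_curve:
  fixes f :: "real^'n::finite \<Rightarrow> real"
  assumes "f differentiable (at (x t))" "(x has_vector_derivative v) (at t)"
  shows "((\<lambda>s. f (x s)) has_real_derivative (\<Sum>j\<in>UNIV. v $ j * pd j f (x t))) (at t)"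
proof -
  have "(f has_derivative frechet_derivative f (at (x t))) (at (x t))"
    using assms(1) by (simp only: frechet_derivative_works)
  from vector_derivative_diff_chain_within[OF assms(2) has_derivative_at_withinI[OF this]]
  have "(f \<circ> x has_vector_derivative frechet_derivative f (at (x t)) v) (at t)" .
  then show ?thesis
    by (simp add: frechet_derivative_eq_sum_pd[OF assms(1)] o_def
        has_real_derivative_iff_has_vector_derivative)
qed

section \<open>Tangent vectors in coordinates\<close>

lemma chart_inv_coord:
  assumes "is_chart c" "p \<in> chart_dom c"
  shows "chart_inv c (coord c p) = p"
  using assms unfolding is_chart_def homeomorphism_def by blast

lemma chart_inv_in_dom:
  assumes "x \<in> chart_image c"
  shows "chart_inv c x \<in> chart_dom c"
  using assms by (rule inv_into_into)

lemma coord_chart_inv: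
  assumes "x \<in> chart_image c"
  shows "coord c (chart_inv c x) = x"
  using assms by (rule f_inv_into_f)

lemma open_chart_image: "is_chart c \<Longrightarrow> open (chart_image c)"
  by (simp add: is_chart_def)

lemma open_coord_image:
  assumes c: "is_chart c" and U: "open U" "U \<subseteq> chart_dom c"
  shows "open (coord c ` U)"
proof -
  have "homeomorphism (chart_dom c) (chart_image c) (coord c) (chart_inv c)"
    using c by (simp add: is_chart_def)
  moreover have "openin (top_of_set (chart_dom c)) U"
    using U by (simp add: openin_open_eq open_subset)
  ultimately have "openin (top_of_set (chart_image c)) (coord c ` U)"
    by (rule homeomorphism_imp_open_map)
  then show ?thesis
    using open_chart_image[OF c] by (metis openin_open_eq)
qed

lemma smooth_manifold_is_chart: "smooth_manifold A \<Longrightarrow> c \<in> A \<Longrightarrow> is_chart c"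
  by (simp add: smooth_manifold_def)

lemma transition_differentiable:
  assumes M: "smooth_manifold A" and cd: "c \<in> A" "d \<in> A"
    and p: "p \<in> chart_dom c" "p \<in> chart_dom d"
  shows "transition c d differentiable (at (coord c p))"
proof (rule smooth_on_differentiable)
  show "smooth_on (coord c ` (chart_dom c \<inter> chart_dom d)) (transition c d)"
    using M cd by (simp add: smooth_manifold_def)
qed (use p in blast)

lemma frechet_derivative_transition_self:
  assumes c: "is_chart c" and x: "x \<in> chart_image c"
  shows "frechet_derivative (transition c c) (at x) y = y"
proof -
  have "(transition c c has_derivative (\<lambda>h. h)) (at x)"
    by (rule has_derivative_transform_within_open[OF _ open_chart_image[OF c] x])
       (auto simp: transition_def coord_chart_inv)
  then show ?thesis by (metis frechet_derivative_at)
qed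

text \<open>The identity \<open>transition c e = transition d e \<circ> transition c d\<close> holds only on the coordinate image of
  \<open>chart_dom c \<inter> chart_dom d\<close>; this set is open, so the chain rule at a point of it is enough.\<close>

lemma frechet_derivative_transition_comp:
  assumes M: "smooth_manifold A" and A: "c \<in> A" "d \<in> A" "e \<in> A"
    and p: "p \<in> chart_dom c" "p \<in> chart_dom d" "p \<in> chart_dom e"
  shows "frechet_derivative (transition c e) (at (coord c p)) y =
    frechet_derivative (transition d e) (at (coord d p))
      (frechet_derivative (transition c d) (at (coord c p)) y)"
proof -
  note ch = smooth_manifold_is_chart[OF M]
  let ?f = "frechet_derivative (transition c d) (at (coord c p))"
  let ?g = "frechet_derivative (transition d e) (at (coord d p))"
  have f: "(transition c d has_derivative ?f) (at (coord c p))"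
    by (rule transition_differentiable[OF M A(1,2) p(1,2), unfolded frechet_derivative_works])
  have tp: "transition c d (coord c p) = coord d p"
    using chart_inv_coord[OF ch[OF A(1)] p(1)] by (simp add: transition_def)
  have g: "(transition d e has_derivative ?g) (at (transition c d (coord c p)))"
    unfolding tp by (rule transition_differentiable[OF M A(2,3) p(2,3), unfolded frechet_derivative_works])
  have fg: "((\<lambda>z. transition d e (transition c d z)) has_derivative (\<lambda>h. ?g (?f h))) (at (coord c p))"
    by (rule has_derivative_compose[OF f g])
  let ?U = "coord c ` (chart_dom c \<inter> chart_dom d)"
  have "open (chart_dom c \<inter> chart_dom d)"
    using ch[OF A(1)] ch[OF A(2)] by (simp add: is_chart_def open_Int)
  then have U: "open ?U" by (rule open_coord_image[OF ch[OF A(1)]]) simp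
  have "(transition c e has_derivative (\<lambda>h. ?g (?f h))) (at (coord c p))"
  proof (rule has_derivative_transform_within_open[OF fg U])
    show "coord c p \<in> ?U" using p by blast
    show "transition d e (transition c d z) = transition c e z" if "z \<in> ?U" for z
      using that chart_inv_coord[OF ch[OF A(1)]] chart_inv_coord[OF ch[OF A(2)]]
      by (auto simp: transition_def)
  qed
  then show ?thesis by (metis frechet_derivative_at)
qed

text \<open>The cocycle rule for Jacobians above is precisely the transformation law of a contravariant
  vector.\<close>

lemma of_components_in_tangent_space:
  assumes M: "smooth_manifold A" and c: "c \<in> A" and x: "x \<in> chart_image c"
  shows "of_components A c x y \<in> tangent_space A (chart_inv c x)"
  unfolding tangent_space_def mem_Collect_eq
proof (intro conjI ballI allI impI)
  note p = chart_inv_in_dom[OF x]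
  fix d e assume d: "d \<in> A" and e: "e \<in> A" and de: "chart_inv c x \<in> chart_dom d \<inter> chart_dom e"
  have "frechet_derivative (transition c e) (at x) y =
      frechet_derivative (transition d e) (at (coord d (chart_inv c x)))
        (frechet_derivative (transition c d) (at x) y)"
    using frechet_derivative_transition_comp[OF M c d e p, of y] de
    by (simp only: coord_chart_inv[OF x] Int_iff)
  then show "of_components A c x y e =
      frechet_derivative (transition d e) (at (coord d (chart_inv c x))) (of_components A c x y d)"
    using d e de by (simp only: of_components_def Int_iff simp_thms if_True)
qed (simp only: of_components_def if_False)

lemma of_components_self:
  assumes M: "smooth_manifold A" and c: "c \<in> A" and x: "x \<in> chart_image c"
  shows "of_components A c x y c = y"
  using frechet_derivative_transition_self[OF smooth_manifold_is_chart[OF M c] x] c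
    chart_inv_in_dom[OF x]
  by (simp add: of_components_def)

lemma of_components_linear:
  assumes M: "smooth_manifold A" and c: "c \<in> A" and x: "x \<in> chart_image c"
  shows "of_components A c x (r *\<^sub>R y + s *\<^sub>R z) =
    (\<lambda>d. r *\<^sub>R of_components A c x y d + s *\<^sub>R of_components A c x z d)"
proof
  fix d
  show "of_components A c x (r *\<^sub>R y + s *\<^sub>R z) d =
    r *\<^sub>R of_components A c x y d + s *\<^sub>R of_components A c x z d"
  proof (cases "d \<in> A \<and> chart_inv c x \<in> chart_dom d")
    case True
    then have "transition c d differentiable (at x)"
      using transition_differentiable[OF M c _ chart_inv_in_dom[OF x], of d]
      by (simp add: coord_chart_inv[OF x])
    from linear_frechet_derivative[OF this] show ?thesis
      using True by (simp add: of_components_def linear_add linear_cmul)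
  next
    case False
    then have "of_components A c x w d = 0" for w by (auto simp: of_components_def)
    then show ?thesis by simp
  qed
qed

section \<open>Coordinate expressions of the one-form and of the fundamental function\<close>

text \<open>The homogeneity and linearity clauses of the two definitions are poor rewrite rules, because their
  left-hand sides match too many terms; unfolding them in the simplifier may loop, so the clauses are
  extracted one at a time.\<close>

lemma finsler_space_smooth_manifold: "finsler_space A L \<Longrightarrow> smooth_manifold A"
  unfolding finsler_space_def by (elim conjE)

lemma finsler_space_pos:
  "finsler_space A L \<Longrightarrow> v \<in> tangent_space A p \<Longrightarrow> v \<noteq> (\<lambda>_. 0) \<Longrightarrow> L p v > 0"
  unfolding finsler_space_def by (elim conjE) (drule spec, drule (1) bspec, erule (1) mp)

lemma finsler_space_smooth:
  "finsler_space A L \<Longrightarrow> c \<in> A \<Longrightarrow> smooth_on (chart_image c \<times> (- {0})) (\<lambda>(x, y). local_rep A L c x y)"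
  unfolding finsler_space_def by (elim conjE) (erule (1) bspec)

lemma one_form_combination:
  assumes "one_form A \<beta>" "v \<in> tangent_space A p" "w \<in> tangent_space A p"
  shows "\<beta> p (\<lambda>c. r *\<^sub>R v c + s *\<^sub>R w c) = r * \<beta> p v + s * \<beta> p w"
  using assms(1)[unfolded one_form_def, THEN conjunct1, THEN spec, THEN bspec, OF assms(2),
      THEN bspec, OF assms(3)] by (elim allE)

lemma one_form_coeff_smooth:
  assumes "one_form A \<beta>" "c \<in> A"
  shows "smooth_on (chart_image c) (one_form_coeff A \<beta> c i)"
  using assms(1)[unfolded one_form_def, THEN conjunct2, THEN bspec, OF assms(2)] by (elim allE)

lemma local_rep_one_form_linear:
  assumes M: "smooth_manifold A" and b: "one_form A \<beta>"
    and c: "c \<in> A" and x: "x \<in> chart_image c"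
  shows "linear (local_rep A \<beta> c x)"
proof -
  have comb: "local_rep A \<beta> c x (r *\<^sub>R y + s *\<^sub>R z) = r * local_rep A \<beta> c x y + s * local_rep A \<beta> c x z"
    for r s y z
    unfolding local_rep_def of_components_linear[OF M c x]
    by (intro one_form_combination[OF b] of_components_in_tangent_space[OF M c x])
  show ?thesis
  proof (rule linearI)
    show "local_rep A \<beta> c x (y + z) = local_rep A \<beta> c x y + local_rep A \<beta> c x z" for y z
      using comb[of 1 y 1 z] by simp
    show "local_rep A \<beta> c x (r *\<^sub>R y) = r *\<^sub>R local_rep A \<beta> c x y" for r y
      using comb[of r y 0 0] by simp
  qed
qed

text \<open>The classical expression \<open>\<beta> = b\<^sub>i(x) y\<^sup>i\<close>, recovered from fibrewise linearity.\<close>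

lemma local_rep_one_form_eq_sum:
  assumes M: "smooth_manifold A" and b: "one_form A \<beta>"
    and c: "c \<in> A" and x: "x \<in> chart_image c"
  shows "local_rep A \<beta> c x y = (\<Sum>j\<in>UNIV. y $ j * one_form_coeff A \<beta> c j x)"
proof -
  note lin = local_rep_one_form_linear[OF M b c x]
  have "local_rep A \<beta> c x y = local_rep A \<beta> c x (\<Sum>j\<in>UNIV. y $ j *\<^sub>R axis j 1)"
    by (simp only: sum_components_axis)
  also have "\<dots> = (\<Sum>j\<in>UNIV. y $ j * one_form_coeff A \<beta> c j x)"
    by (simp add: linear_sum[OF lin] linear_cmul[OF lin] one_form_coeff_def)
  finally show ?thesis .
qed

lemma one_form_coeff_differentiable:
  assumes "one_form A \<beta>" "c \<in> A" "x \<in> chart_image c"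
  shows "one_form_coeff A \<beta> c i differentiable (at x)"
  using one_form_coeff_smooth[OF assms(1,2)] assms(3) by (rule smooth_on_differentiable)

lemma local_rep_one_form_differentiable:
  assumes M: "smooth_manifold A" and b: "one_form A \<beta>"
    and c: "c \<in> A" and x: "x \<in> chart_image c"
  shows "(\<lambda>z. local_rep A \<beta> c z y) differentiable (at x)"
    and "pd i (\<lambda>z. local_rep A \<beta> c z y) x = (\<Sum>j\<in>UNIV. y $ j * pd i (one_form_coeff A \<beta> c j) x)"
proof -
  let ?D = "\<lambda>h. \<Sum>j\<in>UNIV. y $ j * frechet_derivative (one_form_coeff A \<beta> c j) (at x) h"
  have "((\<lambda>z. \<Sum>j\<in>UNIV. y $ j * one_form_coeff A \<beta> c j z) has_derivative ?D) (at x)"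
    by (intro has_derivative_sum has_derivative_mult_right
        one_form_coeff_differentiable[OF b c x, unfolded frechet_derivative_works])
  then have D: "((\<lambda>z. local_rep A \<beta> c z y) has_derivative ?D) (at x)"
    by (rule has_derivative_transform_within_open
          [OF _ open_chart_image[OF smooth_manifold_is_chart[OF M c]] x])
       (simp add: local_rep_one_form_eq_sum[OF M b c])
  then show "(\<lambda>z. local_rep A \<beta> c z y) differentiable (at x)"
    by (auto simp: differentiable_def)
  show "pd i (\<lambda>z. local_rep A \<beta> c z y) x = (\<Sum>j\<in>UNIV. y $ j * pd i (one_form_coeff A \<beta> c j) x)"
    unfolding pd_eqI[OF D] by (simp add: pd_def)
qed

lemma finsler_local_rep_pos:
  assumes F: "finsler_space A L" and c: "c \<in> A" and x: "x \<in> chart_image c" and y: "y \<noteq> 0"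
  shows "local_rep A L c x y > 0"
proof -
  have M: "smooth_manifold A" by (rule finsler_space_smooth_manifold[OF F])
  have "of_components A c x y \<noteq> (\<lambda>_. 0)"
    using of_components_self[OF M c x, of y] y by metis
  from finsler_space_pos[OF F of_components_in_tangent_space[OF M c x] this]
  show ?thesis by (simp only: local_rep_def)
qed

lemma finsler_has_derivative:
  assumes F: "finsler_space A L" and c: "c \<in> A" and x: "x \<in> chart_image c" and y: "y \<noteq> 0"
  shows "((\<lambda>(x, y). local_rep A L c x y) has_derivative
    frechet_derivative (\<lambda>(x, y). local_rep A L c x y) (at (x, y))) (at (x, y))"
proof -
  have "smooth_on (chart_image c \<times> - {0}) (\<lambda>(x, y). local_rep A L c x y)"
    by (rule finsler_space_smooth[OF F c])
  from smooth_on_differentiable[OF this, of "(x, y)"] show ?thesis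
    using x y by (simp add: frechet_derivative_works)
qed

lemma finsler_base_differentiable:
  assumes "finsler_space A L" "c \<in> A" "x \<in> chart_image c" "y \<noteq> 0"
  shows "(\<lambda>z. local_rep A L c z y) differentiable (at x)"
proof -
  have "((\<lambda>z. (z, y)) has_derivative (\<lambda>h. (h, 0))) (at x)"
    by (intro has_derivative_Pair has_derivative_ident has_derivative_const)
  from has_derivative_compose[OF this finsler_has_derivative[OF assms]]
  show ?thesis by (auto simp: differentiable_def)
qed

lemma finsler_fibre_has_derivative:
  assumes "finsler_space A L" "c \<in> A" "x \<in> chart_image c" "y \<noteq> 0"
  shows "(local_rep A L c x has_derivative
    (\<lambda>h. frechet_derivative (\<lambda>(x, y). local_rep A L c x y) (at (x, y)) (0, h))) (at y)"
proof -
  have "((\<lambda>z. (x, z)) has_derivative (\<lambda>h. (0, h))) (at y)"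
    by (intro has_derivative_Pair has_derivative_ident has_derivative_const)
  from has_derivative_compose[OF this finsler_has_derivative[OF assms]]
  show ?thesis by simp
qed

text \<open>The momentum \<open>\<partial>L/\<partial>y\<^sup>i\<close> is jointly differentiable in \<open>(x,y)\<close>, because on the slit bundle it is one of
  the partial derivatives of the smooth function \<open>(x,y) \<mapsto> L(x,y)\<close> on the product space.\<close>

lemma finsler_momentum_differentiable:
  fixes A :: "('m::{t2_space, second_countable_topology}, 'n::finite) chart set"
  assumes F: "finsler_space A L" and c: "c \<in> A" and x: "x \<in> chart_image c" and y: "y \<noteq> 0"
  shows "(\<lambda>(x, y). pd i (local_rep A L c x) y) differentiable (at (x, y))"
proof -
  let ?W = "chart_image c \<times> (- {0 :: real^'n})"
  let ?G = "\<lambda>w. frechet_derivative (\<lambda>(x, y). local_rep A L c x y) (at w) (0, axis i 1)"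
  have sm: "smooth_on ?W (\<lambda>(x, y). local_rep A L c x y)"
    by (rule finsler_space_smooth[OF F c])
  have M: "smooth_manifold A" by (rule finsler_space_smooth_manifold[OF F])
  have xy: "(x, y) \<in> ?W" using x y by simp
  have W: "open ?W"
    using open_chart_image[OF smooth_manifold_is_chart[OF M c]] by (intro open_Times open_Compl closed_singleton)
  have "(0, axis i 1) \<in> (Basis :: ((real^'n) \<times> (real^'n)) set)"
    by (auto simp: Basis_prod_def axis_in_Basis_iff)
  from smooth_on_differentiable[OF smooth_on_frechet_derivative_Basis[OF sm this] xy]
  obtain D where "(?G has_derivative D) (at (x, y))" by (auto simp: differentiable_def)
  then have "((\<lambda>(x, y). pd i (local_rep A L c x) y) has_derivative D) (at (x, y))"
  proof (rule has_derivative_transform_within_open[OF _ W xy])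
    fix w assume "w \<in> ?W"
    then obtain z v where "w = (z, v)" "z \<in> chart_image c" "v \<noteq> 0" by blast
    then show "?G w = (\<lambda>(x, y). pd i (local_rep A L c x) y) w"
      using pd_eqI[OF finsler_fibre_has_derivative[OF F c, of z v], of i] by simp
  qed
  then show ?thesis by (auto simp: differentiable_def)
qed

section \<open>Euler-Lagrange expressions under a Randers conformal change\<close>

text \<open>The last conclusion is stated for a neighbourhood of \<open>t\<close> and not just at \<open>t\<close>, since the momentum
  has to be rewritten under a time derivative.\<close>

lemma regular_curve_coordinates:
  fixes A :: "('m::topological_space, 'n::finite) chart set"
  assumes reg: "regular_curve A I \<gamma>" and c: "c \<in> A" "is_chart c"
    and t: "t \<in> I" "\<gamma> t \<in> chart_dom c"
  defines "x \<equiv> coord c \<circ> \<gamma>"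
  defines "y \<equiv> \<lambda>s. vector_derivative x (at s)"
  shows "(x has_vector_derivative y t) (at t)" "y differentiable (at t)"
    "\<forall>\<^sub>F s in nhds t. x s \<in> chart_image c \<and> y s \<noteq> 0"
proof -
  let ?J = "{s \<in> I. \<gamma> s \<in> chart_dom c}"
  have "open I" "continuous_on I \<gamma>" using reg by (auto simp: regular_curve_def)
  moreover have "open (chart_dom c)" using c by (simp add: is_chart_def)
  ultimately have "open (I \<inter> \<gamma> -` chart_dom c)" by (intro continuous_open_preimage)
  moreover have "I \<inter> \<gamma> -` chart_dom c = ?J" by auto
  ultimately have J: "open ?J" by simp
  have tJ: "t \<in> ?J" using t by simp
  have sm: "smooth_on ?J x" and nz: "\<And>s. s \<in> ?J \<Longrightarrow> y s \<noteq> 0"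
    using reg c by (auto simp: regular_curve_def x_def y_def)
  show "(x has_vector_derivative y t) (at t)"
    using smooth_on_differentiable[OF sm tJ] unfolding y_def
    by (simp add: vector_derivative_works)
  have y_eq: "frechet_derivative x (at s) 1 = y s" if "s \<in> ?J" for s
  proof -
    have "(x has_vector_derivative y s) (at s)"
      using smooth_on_differentiable[OF sm that] unfolding y_def
      by (simp add: vector_derivative_works)
    then have "(x has_derivative (\<lambda>h. h *\<^sub>R y s)) (at s)"
      by (simp add: has_vector_derivative_def)
    then show ?thesis by (metis frechet_derivative_at scaleR_one)
  qed
  have "(\<lambda>s. frechet_derivative x (at s) 1) differentiable (at t)"
    by (rule smooth_on_differentiable[OF smooth_on_frechet_derivative_Basis[OF sm] tJ]) simp
  then obtain D where "((\<lambda>s. frechet_derivative x (at s) 1) has_derivative D) (at t)"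
    by (auto simp: differentiable_def)
  then have "(y has_derivative D) (at t)"
    by (rule has_derivative_transform_within_open[OF _ J tJ]) (rule y_eq)
  then show "y differentiable (at t)" by (auto simp: differentiable_def)
  show "\<forall>\<^sub>F s in nhds t. x s \<in> chart_image c \<and> y s \<noteq> 0"
    unfolding eventually_nhds using J tJ nz by (intro exI[of _ ?J]) (auto simp: x_def)
qed

text \<open>The formula is the product rule: the derivative of \<open>e\<^sup>\<sigma> \<partial>L/\<partial>y\<^sup>i\<close> along the curve contributes
  \<open>e\<^sup>\<sigma> (d\<sigma>/dt) \<partial>L/\<partial>y\<^sup>i\<close>, while \<open>e\<^sup>\<sigma> L \<partial>\<^sub>i\<sigma>\<close>, \<open>\<partial>\<^sub>i\<beta>\<close> and \<open>- db\<^sub>i/dt\<close> make up the covector \<open>A\<^sub>i\<close>.\<close>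

lemma randers_euler_lagrange:
  fixes A :: "('m::{t2_space, second_countable_topology}, 'n::finite) chart set"
  assumes F: "finsler_space A L" and sig: "smooth_function A \<sigma>" and b: "one_form A \<beta>"
    and reg: "regular_curve A I \<gamma>" and c: "c \<in> A"
    and t: "t \<in> I" "\<gamma> t \<in> chart_dom c"
  defines "x \<equiv> coord c \<circ> \<gamma>"
  defines "y \<equiv> \<lambda>s. vector_derivative x (at s)"
  shows "euler_lagrange A (randers_conformal \<sigma> \<beta> L) c \<gamma> i t =
    exp (\<sigma> (\<gamma> t)) * euler_lagrange A L c \<gamma> i t
    + randers_covector A \<sigma> \<beta> L c i (x t) (y t)
    - exp (\<sigma> (\<gamma> t)) * (\<Sum>j\<in>UNIV. y t $ j * pd j (\<sigma> \<circ> chart_inv c) (x t))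
        * pd i (local_rep A L c (x t)) (y t)"
proof -
  have M: "smooth_manifold A" by (rule finsler_space_smooth_manifold[OF F])
  note ch = smooth_manifold_is_chart[OF M c]
  have y_at: "y s = vector_derivative x (at s)" for s
    by (simp only: y_def)
  note curve = regular_curve_coordinates[OF reg c ch t, folded x_def, folded y_at]
  let ?L' = "local_rep A (randers_conformal \<sigma> \<beta> L) c"
  let ?L = "local_rep A L c"
  let ?S = "\<sigma> \<circ> chart_inv c"
  let ?b = "one_form_coeff A \<beta> c"
  have L': "?L' z w = exp (?S z) * ?L z w + local_rep A \<beta> c z w" for z w
    by (simp add: local_rep_def randers_conformal_def)
  have xt: "x t \<in> chart_image c" and yt: "y t \<noteq> 0"
    using eventually_nhds_x_imp_x[OF curve(3)] by blast+
  have Sx: "?S (x t) = \<sigma> (\<gamma> t)" using chart_inv_coord[OF ch t(2)] by (simp add: x_def)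
  have dS: "?S differentiable (at (x t))"
    using sig c by (intro smooth_on_differentiable[OF _ xt]) (simp add: smooth_function_def)
  then have DS: "(?S has_derivative frechet_derivative ?S (at (x t))) (at (x t))"
    using dS by (simp only: frechet_derivative_works)

  have base: "pd i (\<lambda>z. ?L' z (y t)) (x t) =
      exp (\<sigma> (\<gamma> t)) * pd i ?S (x t) * ?L (x t) (y t)
      + exp (\<sigma> (\<gamma> t)) * pd i (\<lambda>z. ?L z (y t)) (x t)
      + pd i (\<lambda>z. local_rep A \<beta> c z (y t)) (x t)"
  proof -
    let ?DL = "frechet_derivative (\<lambda>z. ?L z (y t)) (at (x t))"
    let ?D\<beta> = "frechet_derivative (\<lambda>z. local_rep A \<beta> c z (y t)) (at (x t))"
    have DL: "((\<lambda>z. ?L z (y t)) has_derivative ?DL) (at (x t))"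
      by (rule finsler_base_differentiable[OF F c xt yt, unfolded frechet_derivative_works])
    have D\<beta>: "((\<lambda>z. local_rep A \<beta> c z (y t)) has_derivative ?D\<beta>) (at (x t))"
      by (rule local_rep_one_form_differentiable(1)[OF M b c xt, unfolded frechet_derivative_works])
    have "((\<lambda>z. exp (?S z)) has_derivative
        (\<lambda>h. exp (?S (x t)) * frechet_derivative ?S (at (x t)) h)) (at (x t))"
      using has_derivative_exp[OF DS] by (simp add: mult.commute)
    from has_derivative_add[OF has_derivative_mult[OF this DL] D\<beta>]
    show ?thesis unfolding L' by (subst pd_eqI, assumption) (simp add: pd_def Sx[simplified])
  qed

  have fibre: "pd i (?L' z) w = exp (?S z) * pd i (?L z) w + ?b i z"
    if z: "z \<in> chart_image c" and w: "w \<noteq> 0" for z w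
  proof -
    have D: "(?L z has_derivative frechet_derivative (?L z) (at w)) (at w)"
      using finsler_fibre_has_derivative[OF F c z w] by (metis frechet_derivative_at)
    have D\<beta>: "(local_rep A \<beta> c z has_derivative local_rep A \<beta> c z) (at w)"
      using local_rep_one_form_linear[OF M b c z]
      by (intro bounded_linear_imp_has_derivative) (simp add: linear_conv_bounded_linear)
    have "(?L' z has_derivative (\<lambda>h. exp (?S z) * frechet_derivative (?L z) (at w) h
        + local_rep A \<beta> c z h)) (at w)"
      using has_derivative_add[OF has_derivative_mult_right[OF D, of "exp (?S z)"] D\<beta>]
      unfolding L'[abs_def] .
    then show ?thesis by (subst pd_eqI, assumption) (simp add: pd_def one_form_coeff_def)
  qed

  define P where "P s = pd i (?L (x s)) (y s)" for s
  have DP: "(P has_real_derivative deriv P t) (at t)"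
  proof -
    obtain G where G: "((\<lambda>(x, y). pd i (?L x) y) has_derivative G) (at (x t, y t))"
      using finsler_momentum_differentiable[OF F c xt yt] by (auto simp: differentiable_def)
    obtain Y where Y: "(y has_derivative Y) (at t)"
      using curve(2) by (auto simp: differentiable_def)
    have "((\<lambda>s. (x s, y s)) has_derivative (\<lambda>h. (h *\<^sub>R y t, Y h))) (at t)"
      using curve(1) Y by (intro has_derivative_Pair) (simp_all add: has_vector_derivative_def)
    from has_derivative_compose[OF this, OF G]
    have "P differentiable (at t)" unfolding P_def[abs_def] by (auto simp: differentiable_def)
    then show ?thesis
      by (simp add: DERIV_deriv_iff_real_differentiable)
  qed
  let ?dS = "\<Sum>j\<in>UNIV. y t $ j * pd j ?S (x t)"
  let ?db = "\<Sum>j\<in>UNIV. y t $ j * pd j (?b i) (x t)"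
  have DSx: "((\<lambda>s. exp (?S (x s))) has_real_derivative exp (?S (x t)) * ?dS) (at t)"
    by (rule DERIV_fun_exp[OF has_real_derivative_along_curve[OF dS curve(1)]])
  have Db: "((\<lambda>s. ?b i (x s)) has_real_derivative ?db) (at t)"
    by (rule has_real_derivative_along_curve[OF one_form_coeff_differentiable[OF b c xt] curve(1)])
  have ev: "\<forall>\<^sub>F s in nhds t. pd i (?L' (x s)) (y s) = exp (?S (x s)) * P s + ?b i (x s)"
    using curve(3) unfolding P_def by (rule eventually_mono) (blast intro: fibre)
  have "((\<lambda>s. exp (?S (x s)) * P s + ?b i (x s)) has_real_derivative
      (exp (?S (x t)) * ?dS * P t + deriv P t * exp (?S (x t)) + ?db)) (at t)"
    by (rule DERIV_add[OF DERIV_mult[OF DSx DP] Db])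
  then have "((\<lambda>s. pd i (?L' (x s)) (y s)) has_real_derivative
      (exp (?S (x t)) * ?dS * P t + deriv P t * exp (?S (x t)) + ?db)) (at t)"
    by (subst DERIV_cong_ev[OF refl ev refl])
  then have time: "deriv (\<lambda>s. pd i (?L' (x s)) (y s)) t =
      exp (\<sigma> (\<gamma> t)) * ?dS * P t + deriv P t * exp (\<sigma> (\<gamma> t)) + ?db"
    unfolding Sx by (rule DERIV_imp_deriv)
  have EL: "euler_lagrange A N c \<gamma> i t = pd i (\<lambda>z. local_rep A N c z (y t)) (x t)
      - deriv (\<lambda>s. pd i (local_rep A N c (x s)) (y s)) t" for N
    by (simp add: euler_lagrange_def Let_def x_def y_def)
  have RC: "randers_covector A \<sigma> \<beta> L c i (x t) (y t) =
      exp (\<sigma> (\<gamma> t)) * ?L (x t) (y t) * pd i ?S (x t)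
      + pd i (\<lambda>z. local_rep A \<beta> c z (y t)) (x t) - ?db"
    using Sx by (simp add: randers_covector_def)
  show ?thesis
    unfolding EL RC base time P_def[symmetric] by (simp add: algebra_simps P_def[abs_def])
qed

text \<open>Contracting with \<open>y\<^sup>i\<close> cancels the \<open>\<beta>\<close>-part, as \<open>y\<^sup>i y\<^sup>j \<partial>\<^sub>i b\<^sub>j\<close> is unchanged when the summation indices
  \<open>i\<close> and \<open>j\<close> are exchanged.\<close>

lemma randers_covector_contraction:
  assumes M: "smooth_manifold A" and b: "one_form A \<beta>"
    and c: "c \<in> A" and x: "x \<in> chart_image c"
  shows "(\<Sum>i\<in>UNIV. y $ i * randers_covector A \<sigma> \<beta> L c i x y) =
    exp (\<sigma> (chart_inv c x)) * local_rep A L c x y * (\<Sum>i\<in>UNIV. y $ i * pd i (\<sigma> \<circ> chart_inv c) x)"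
proof -
  let ?b = "\<lambda>i j. y $ i * (y $ j * pd i (one_form_coeff A \<beta> c j) x)"
  have "(\<Sum>i\<in>UNIV. \<Sum>j\<in>UNIV. ?b j i) = (\<Sum>i\<in>UNIV. \<Sum>j\<in>UNIV. ?b i j)"
    by (rule sum.swap)
  then have "(\<Sum>i\<in>UNIV. y $ i * (\<Sum>j\<in>UNIV. y $ j * pd i (one_form_coeff A \<beta> c j) x))
      = (\<Sum>i\<in>UNIV. y $ i * (\<Sum>j\<in>UNIV. y $ j * pd j (one_form_coeff A \<beta> c i) x))"
    by (simp add: sum_distrib_left mult.left_commute)
  moreover have "y $ i * randers_covector A \<sigma> \<beta> L c i x y =
      exp (\<sigma> (chart_inv c x)) * local_rep A L c x y * (y $ i * pd i (\<sigma> \<circ> chart_inv c) x)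
      + y $ i * (\<Sum>j\<in>UNIV. y $ j * pd i (one_form_coeff A \<beta> c j) x)
      - y $ i * (\<Sum>j\<in>UNIV. y $ j * pd j (one_form_coeff A \<beta> c i) x)" for i
    unfolding randers_covector_def local_rep_one_form_differentiable(2)[OF M b c x]
    by (simp only: right_diff_distrib distrib_left ac_simps)
  ultimately show ?thesis
    by (simp only: sum_subtractf sum.distrib sum_distrib_left[symmetric] add_diff_cancel_right')
qed

theorem proposition3p1:
  fixes A :: "('m::{t2_space, second_countable_topology}, 'n::finite) chart set"
    and L \<beta> :: "'m \<Rightarrow> ('m, 'n) tangent \<Rightarrow> real"
    and \<sigma> :: "'m \<Rightarrow> real"
  assumes "finsler_space A L"
    and "smooth_function A \<sigma>"
    and "one_form A \<beta>"
    and "finsler_space A (randers_conformal \<sigma> \<beta> L)"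
    and "\<And>c i x y. c \<in> A \<Longrightarrow> x \<in> chart_image c \<Longrightarrow> y \<noteq> 0 \<Longrightarrow>
           randers_covector A \<sigma> \<beta> L c i x y = 0"
  shows "projective_change A L (randers_conformal \<sigma> \<beta> L)"
proof -
  have M: "smooth_manifold A" by (rule finsler_space_smooth_manifold[OF assms(1)])
  \<comment> \<open>Dividing the contracted identity by \<open>e\<^sup>\<sigma> L > 0\<close>.\<close>
  have d\<sigma>: "(\<Sum>j\<in>UNIV. y $ j * pd j (\<sigma> \<circ> chart_inv c) x) = 0"
    if "c \<in> A" "x \<in> chart_image c" "y \<noteq> 0" for c x and y :: "real^'n"
    using randers_covector_contraction[OF M assms(3) that(1,2), of y \<sigma> L] assms(5)[OF that]
      finsler_local_rep_pos[OF assms(1) that] by simp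
  have EL: "euler_lagrange A (randers_conformal \<sigma> \<beta> L) c \<gamma> i t =
      exp (\<sigma> (\<gamma> t)) * euler_lagrange A L c \<gamma> i t"
    if reg: "regular_curve A I \<gamma>" and c: "c \<in> A" and t: "t \<in> I" "\<gamma> t \<in> chart_dom c"
    for I \<gamma> c i t
  proof -
    have "(coord c \<circ> \<gamma>) t \<in> chart_image c" using t by simp
    moreover have "vector_derivative (coord c \<circ> \<gamma>) (at t) \<noteq> 0"
      using reg c t by (simp add: regular_curve_def)
    ultimately show ?thesis
      using randers_euler_lagrange[OF assms(1-3) that, of i] assms(5)[OF c] d\<sigma>[OF c] by simp
  qed
  then show ?thesis
    unfolding projective_change_def geodesic_def by (metis exp_not_eq_zero mult_eq_0_iff)
qed

end
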